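(* Let $\mu$ and $\nu$ be finite Borel measures on $\mathbb{R}^d$ whose supports are compact and disjoint. Then $$\dim_{\mathrm{F}}(\mu+\nu)=\min(\dim_{\mathrm{F}}\mu,\ \dim_{\mathrm{F}}\nu).$$
   Context: For a finite Borel measure $\mu$ on $\mathbb{R}^d$, $\widehat\mu(\xi)=\int e^{-2\pi i \xi\cdot x}\,d\mu(x)$ for $\xi\in\mathbb{R}^d$. The notation $f(\xi)\lesssim g(\xi)$ means there is a constant $C$ with $|f(\xi)|\le C|g(\xi)|$ for all $\xi$ (negative powers of $|\xi|$ are read as $+\infty$ at $\xi=0$). The Fourier dimension of $\mu$ is $\dim_{\mathrm{F}}\mu=\sup\{s\in[0,d]:\ \widehat\mu(\xi)\lesssim|\xi|^{-s/2}\}$. *)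

theory Defs
  imports "HOL-Analysis.Analysis"
begin

definition finite_borel_measure :: "'a::topological_space measure \<Rightarrow> bool" where
  "finite_borel_measure M \<longleftrightarrow> finite_measure M \<and> sets M = sets borel"

definition measure_support :: "'a::topological_space measure \<Rightarrow> 'a set" where
  "measure_support M = {x. \<forall>U. open U \<and> x \<in> U \<longrightarrow> emeasure M U > 0}"

definition add_measure :: "'a measure \<Rightarrow> 'a measure \<Rightarrow> 'a measure" where
  "add_measure M N = measure_of (space M) (sets M) (\<lambda>A. emeasure M A + emeasure N A)"

lemma space_add_measure [simp]: "space (add_measure M N) = space M"
  by (simp add: add_measure_def)

lemma sets_add_measure [simp]: "sets (add_measure M N) = sets M"
  by (simp add: add_measure_def)

lemma emeasure_add_measure:
  assumes "sets M = sets N"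
  shows "emeasure (add_measure M N) A = emeasure M A + emeasure N A"
proof (cases "A \<in> sets M")
  case True
  have "countably_additive (sets M) (\<lambda>A. emeasure M A + emeasure N A)"
  proof (rule countably_additiveI)
    fix A :: "nat \<Rightarrow> _"
    assume A: "range A \<subseteq> sets M" "disjoint_family A"
    with assms have "range A \<subseteq> sets N"
      by simp
    with A show "(\<Sum>i. emeasure M (A i) + emeasure N (A i)) =
        emeasure M (\<Union>i. A i) + emeasure N (\<Union>i. A i)"
      by (simp add: suminf_add[symmetric] suminf_emeasure)
  qed
  with True show ?thesis
    unfolding add_measure_def
    by (intro emeasure_measure_of_sigma) (auto simp: positive_def sets.sigma_algebra_axioms)
next
  case False
  with assms show ?thesis
    by (simp add: emeasure_notin_sets)
qed

definition fourier_measure :: "'a::euclidean_space measure \<Rightarrow> 'a \<Rightarrow> complex" where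
  "fourier_measure M \<xi> = (\<integral>x. exp (- 2 * of_real pi * \<i> * of_real (\<xi> \<bullet> x)) \<partial>M)"

(* At the origin the bound is vacuous for s > 0, negative powers of 0 being infinite there, and for
   s = 0 it only asks C to be at least a given finite number.  The point \<xi> = 0, where the
   convention 0 powr a = 0 would give the wrong bound, is therefore left out. *)
definition fourier_decay :: "'a::euclidean_space measure \<Rightarrow> real \<Rightarrow> bool" where
  "fourier_decay M s \<longleftrightarrow>
    (\<exists>C::real. \<forall>\<xi>. \<xi> \<noteq> 0 \<longrightarrow> norm (fourier_measure M \<xi>) \<le> C * norm \<xi> powr (- s / 2))"

definition fourier_dim :: "'a::euclidean_space measure \<Rightarrow> real" where
  "fourier_dim M = Sup {s. 0 \<le> s \<and> s \<le> real DIM('a) \<and> fourier_decay M s}"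

end

theory Submission
  imports "HOL-Probability.Levy" Defs
begin

text \<open>Only the decay of \<open>\<mu>\<close> given that of \<open>\<mu> + \<nu>\<close> needs an argument. Let \<open>\<phi>\<close> be \<open>1\<close> on the support of
  \<open>\<mu>\<close> and \<open>0\<close> on that of \<open>\<nu>\<close>, so that \<open>\<mu> = \<phi> (\<mu> + \<nu>)\<close>. If \<open>\<phi>\<close> is a superposition of characters with
  rapidly decaying weight, then the transform of \<open>\<mu>\<close> is an average of frequency shifts of that of
  \<open>\<mu> + \<nu>\<close>, and Peetre's inequality preserves the decay rate. Functions whose multiplication
  preserves decay are closed under products and under \<open>\<phi> \<mapsto> 1 - \<phi>\<close>, so a suitable \<open>\<phi>\<close> is built, by
  covering the compact support with finitely many small cubes, from a cutoff in one coordinate.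
  That cutoff comes from Levy's inversion formula applied to the sum of many independent uniform
  variables: its characteristic function decays as fast as required.\<close>

section \<open>Cutoffs on the line as Fourier integrals\<close>

text \<open>Convolution is encoded as the law of a sum on the product space, where Fubini factors
  the exponential. Each further independent summand thus multiplies the characteristic function by
  another decaying factor.\<close>

lemma char_convolution_pair:
  assumes "real_distribution M" "real_distribution N"
  defines "D \<equiv> distr (M \<Otimes>\<^sub>M N) borel (\<lambda>(x, y). x + y)"
  shows "real_distribution D" "char D t = char M t * char N t"
proof -
  interpret M: real_distribution M by fact
  interpret N: real_distribution N by fact
  interpret P: pair_prob_space M N ..
  interpret D: real_distribution D
    unfolding D_def by (rule P.real_distribution_distr) auto
  show "real_distribution D" ..
  have "integrable (M \<Otimes>\<^sub>M N) (\<lambda>z. iexp (t * fst z + t * snd z))"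
    by (rule P.integrable_iexp) auto
  then have int: "integrable (M \<Otimes>\<^sub>M N) (\<lambda>z. iexp (t * fst z) * iexp (t * snd z))"
    by (simp add: exp_add distrib_left)
  have "char D t = (CLINT z | M \<Otimes>\<^sub>M N. iexp (t * fst z) * iexp (t * snd z))"
    unfolding char_def D_def
    by (subst integral_distr) (auto simp: case_prod_beta algebra_simps exp_add intro!: Bochner_Integration.integral_cong)
  also have "\<dots> = (CLINT x | M. (CLINT y | N. iexp (t * x) * iexp (t * y)))"
    using P.integral_fst'[OF int] by simp
  also have "\<dots> = char M t * char N t"
    unfolding char_def by simp
  finally show "char D t = char M t * char N t" .
qed

text \<open>The exponential has the antiderivative \<open>iexp (t * x) / (\<i> * t)\<close>. Its two
  boundary values have modulus \<open>1 / \<bar>t\<bar>\<close> each, and the density contributes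
  \<open>1 / (2 * a)\<close>.\<close>

lemma char_uniform_measure_bound:
  fixes a t :: real
  assumes "0 < a" "t \<noteq> 0"
  shows "norm (char (uniform_measure lborel {-a..a}) t) \<le> 1 / (a * \<bar>t\<bar>)"
proof -
  let ?I = "CLBINT x. indicator {-a..a} x *\<^sub>R iexp (t * x)"
  let ?F = "\<lambda>x. iexp (t * x) / (\<i> * t)"
  have "uniform_measure lborel {-a..a} = density lborel (\<lambda>x. ennreal (indicator {-a..a} x / (2 * a)))"
    unfolding uniform_measure_def using assms
    by (intro density_cong) (auto simp: divide_ennreal[symmetric] ennreal_indicator split: split_indicator)
  then have "char (uniform_measure lborel {-a..a}) t = (CLBINT x. (indicator {-a..a} x / (2 * a)) *\<^sub>R iexp (t * x))"
    unfolding char_def using assms by (simp add: integral_density)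
  also have "\<dots> = (CLBINT x. (1 / (2 * a)) *\<^sub>R (indicator {-a..a} x *\<^sub>R iexp (t * x)))"
    by simp
  also have "\<dots> = (1 / (2 * a)) *\<^sub>R ?I"
    by (rule integral_scaleR_right)
  also have "?I = ?F a - ?F (- a)"
  proof (rule integral_FTC_atLeastAtMost)
    show "(?F has_vector_derivative iexp (t * x)) (at x within {-a..a})" for x
    proof -
      have "((\<lambda>z. exp (\<i> * (t * z)) / (\<i> * t)) has_field_derivative iexp (t * x)) (at (of_real x))"
        using assms by (auto intro!: derivative_eq_intros simp: field_simps)
      from has_vector_derivative_real_field[OF this] show ?thesis by simp
    qed
  qed (use assms in \<open>auto intro!: continuous_intros\<close>)
  finally have "norm (char (uniform_measure lborel {-a..a}) t) = norm (?F a - ?F (- a)) / (2 * a)"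
    using assms by (simp del: of_real_mult)
  also have "\<dots> \<le> (1 / \<bar>t\<bar> + 1 / \<bar>t\<bar>) / (2 * a)"
    using assms by (intro divide_right_mono order_trans[OF norm_triangle_ineq4] add_mono)
      (auto simp: norm_divide norm_mult)
  finally show ?thesis by (simp add: field_simps)
qed

lemma exists_distribution_with_char_decay:
  fixes r :: real
  assumes "0 < r"
  shows "\<exists>M C. real_distribution M \<and> (AE x in M. \<bar>x\<bar> \<le> r) \<and>
    (\<forall>t. t \<noteq> 0 \<longrightarrow> norm (char M t) \<le> C / \<bar>t\<bar> ^ n)"
proof -
  \<comment> \<open>Of the sum of \<open>Suc n\<close> independent uniform variables on
    \<open>[-a, a]\<close>, \<open>n\<close> supply the decay. One extra summand lets the induction
    start at \<open>k = 0\<close> with a genuine distribution, and its factor is bounded by 1. With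
    this \<open>a\<close> the sum stays in \<open>[-r, r]\<close>.\<close>
  define a where "a = r / real (Suc n)"
  have a: "0 < a" using assms by (simp add: a_def)
  define U where "U = uniform_measure lborel {-a..a}"
  have prob: "prob_space U"
    unfolding U_def by (rule prob_space_uniform_measure) (use a in auto)
  then have U: "real_distribution U"
    by (simp add: real_distribution_def real_distribution_axioms_def U_def)
  have AE_U: "AE x in U. \<bar>x\<bar> \<le> a"
    unfolding U_def by (rule AE_uniform_measureI) (auto)
  have "\<exists>M. real_distribution M \<and> (AE x in M. \<bar>x\<bar> \<le> real (Suc k) * a) \<and>
      (\<forall>t. norm (char M t) \<le> norm (char U t) ^ k)" for k
  proof (induction k)
    case 0
    interpret real_distribution U by fact
    show ?case using U AE_U cmod_char_le_1 by (intro exI[of _ U]) auto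
  next
    case (Suc k)
    then obtain M where M: "real_distribution M" "AE x in M. \<bar>x\<bar> \<le> real (Suc k) * a"
      "\<And>t. norm (char M t) \<le> norm (char U t) ^ k" by blast
    interpret M: real_distribution M by fact
    interpret U: real_distribution U by fact
    interpret P: pair_prob_space M U ..
    let ?D = "distr (M \<Otimes>\<^sub>M U) borel (\<lambda>(x, y). x + y)"
    have "AE z in M \<Otimes>\<^sub>M U. \<bar>fst z\<bar> \<le> real (Suc k) * a \<and> \<bar>snd z\<bar> \<le> a"
    proof (rule P.AE_pair_measure)
      show "{z \<in> space (M \<Otimes>\<^sub>M U). \<bar>fst z\<bar> \<le> real (Suc k) * a \<and> \<bar>snd z\<bar> \<le> a} \<in> sets (M \<Otimes>\<^sub>M U)"
        by measurable
      show "AE x in M. AE y in U. \<bar>fst (x, y)\<bar> \<le> real (Suc k) * a \<and> \<bar>snd (x, y)\<bar> \<le> a"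
        using M(2) by eventually_elim (use AE_U in auto)
    qed
    then have "AE z in M \<Otimes>\<^sub>M U. \<bar>case z of (x, y) \<Rightarrow> x + y\<bar> \<le> real (Suc (Suc k)) * a"
      by eventually_elim (auto simp: algebra_simps)
    then have "AE x in ?D. \<bar>x\<bar> \<le> real (Suc (Suc k)) * a"
      by (subst AE_distr_iff) auto
    then show ?case
      using M(3) char_convolution_pair[OF M(1) U]
      by (intro exI[of _ ?D]) (auto simp: norm_mult mult.commute[of "norm (char U _)"] intro!: mult_right_mono)
  qed
  from this[of n] obtain M where M: "real_distribution M" "AE x in M. \<bar>x\<bar> \<le> r"
      "\<And>t. norm (char M t) \<le> norm (char U t) ^ n" by (auto simp: a_def)
  have "norm (char M t) \<le> (1 / a ^ n) / \<bar>t\<bar> ^ n" if "t \<noteq> 0" for t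
  proof -
    have "norm (char M t) \<le> norm (char U t) ^ n" by fact
    also have "\<dots> \<le> (1 / (a * \<bar>t\<bar>)) ^ n"
      unfolding U_def by (intro power_mono char_uniform_measure_bound a that) auto
    also have "\<dots> = (1 / a ^ n) / \<bar>t\<bar> ^ n" by (simp add: power_divide power_mult_distrib)
    finally show ?thesis .
  qed
  with M show ?thesis by blast
qed

text \<open>Comparison with \<open>1 / (1 + t^2)\<close>: near 0 the uniform bound \<open>A\<close>
  suffices, and elsewhere the two powers of decay beyond the weight leave
  \<open>1 / t^2\<close>.\<close>

lemma integrable_power_weight:
  fixes f :: "real \<Rightarrow> complex"
  assumes "f \<in> borel_measurable borel" "\<And>t. norm (f t) \<le> A"
    and "\<And>t. t \<noteq> 0 \<Longrightarrow> norm (f t) \<le> B / \<bar>t\<bar> ^ (p + 2)"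
  shows "integrable lborel (\<lambda>t. (1 + \<bar>t\<bar>) ^ p *\<^sub>R f t)"
proof (rule Bochner_Integration.integrable_bound)
  \<comment> \<open>The factor \<open>2 ^ p\<close> comes from bounding
    \<open>1 + \<bar>t\<bar>\<close> by 2 or by \<open>2 * \<bar>t\<bar>\<close>, and one more 2
    from bounding \<open>1 + t^2\<close> by 2 or by \<open>2 * t^2\<close>. Absolute values are
    taken because the signs of \<open>A\<close> and \<open>B\<close> are unknown.\<close>
  let ?K = "2 ^ Suc p * (\<bar>A\<bar> + \<bar>B\<bar>)"
  show "integrable lborel (\<lambda>t::real. ?K * inverse (1 + t\<^sup>2))"
    using integrable_inverse_1_plus_square
    by (intro integrable_mult_right) (simp add: set_integrable_def einterval_def)
  have "norm ((1 + \<bar>t\<bar>) ^ p *\<^sub>R f t) \<le> norm (?K * inverse (1 + t\<^sup>2))" for t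
  proof (cases "\<bar>t\<bar> \<le> 1")
    case True
    then have *: "(1 + \<bar>t\<bar>) ^ p \<le> 2 ^ p" by (intro power_mono) auto
    have "norm (f t) \<le> \<bar>A\<bar> + \<bar>B\<bar>" using assms(2)[of t] by linarith
    with * have "norm ((1 + \<bar>t\<bar>) ^ p *\<^sub>R f t) \<le> 2 ^ p * (\<bar>A\<bar> + \<bar>B\<bar>)"
      unfolding norm_scaleR by (intro mult_mono) auto
    also have "\<dots> = ?K * (1 / 2)" by simp
    also have "\<dots> \<le> ?K * inverse (1 + t\<^sup>2)"
    proof (intro mult_left_mono)
      have "t\<^sup>2 \<le> 1" using True by (simp add: abs_square_le_1)
      then show "1 / 2 \<le> inverse (1 + t\<^sup>2)"
        by (simp add: inverse_eq_divide field_simps add_pos_nonneg)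
    qed auto
    finally show ?thesis by (simp add: abs_mult)
  next
    case False
    then have *: "(1 + \<bar>t\<bar>) ^ p \<le> (2 * \<bar>t\<bar>) ^ p" by (intro power_mono) auto
    have "norm (f t) \<le> B / \<bar>t\<bar> ^ (p + 2)" using False by (intro assms(3)) auto
    also have "\<dots> \<le> (\<bar>A\<bar> + \<bar>B\<bar>) / \<bar>t\<bar> ^ (p + 2)"
      by (intro divide_right_mono) auto
    finally have "norm ((1 + \<bar>t\<bar>) ^ p *\<^sub>R f t) \<le> (2 * \<bar>t\<bar>) ^ p * ((\<bar>A\<bar> + \<bar>B\<bar>) / \<bar>t\<bar> ^ (p + 2))"
      unfolding norm_scaleR using * by (intro mult_mono) auto
    also have "\<dots> = 2 ^ p * (\<bar>A\<bar> + \<bar>B\<bar>) / t\<^sup>2"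
      using False by (simp only: power_add power2_abs power_mult_distrib) (simp add: field_simps)
    also have "\<dots> = ?K * (1 / (2 * t\<^sup>2))" by simp
    also have "\<dots> \<le> ?K * inverse (1 + t\<^sup>2)"
    proof (intro mult_left_mono)
      have "1 \<le> t\<^sup>2" using False by (metis abs_square_le_1 linorder_le_cases)
      then have "inverse (2 * t\<^sup>2) \<le> inverse (1 + t\<^sup>2)"
        by (intro le_imp_inverse_le) (auto simp: add_pos_nonneg)
      then show "1 / (2 * t\<^sup>2) \<le> inverse (1 + t\<^sup>2)"
        by (simp only: inverse_eq_divide)
    qed auto
    finally show ?thesis by (simp add: abs_mult)
  qed
  then show "AE t in lborel. norm ((1 + \<bar>t\<bar>) ^ p *\<^sub>R f t) \<le> norm (?K * inverse (1 + t\<^sup>2))"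
    by simp
qed (use assms(1) in measurable)

text \<open>Levy inversion is stated with truncated integrals; for an integrable integrand,
  dominated convergence identifies their limit with the full integral.\<close>

lemma tendsto_symmetric_interval_integral:
  fixes g :: "real \<Rightarrow> complex"
  assumes "integrable lborel g"
  shows "(\<lambda>n::nat. CLBINT t=-real n..real n. g t) \<longlonglongrightarrow> (CLBINT t. g t)"
proof -
  have [measurable]: "g \<in> borel_measurable borel" using assms by auto
  have "(\<lambda>n::nat. CLBINT t. indicator {-real n<..<real n} t *\<^sub>R g t) \<longlonglongrightarrow> (CLBINT t. g t)"
  proof (rule integral_dominated_convergence[where w = "\<lambda>t. norm (g t)"])
    show "AE t in lborel. (\<lambda>n. indicator {-real n<..<real n} t *\<^sub>R g t) \<longlonglongrightarrow> g t"
    proof (intro AE_I2 tendsto_eventually)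
      fix t :: real
      obtain N where N: "\<bar>t\<bar> < real N" using reals_Archimedean2 by blast
      show "\<forall>\<^sub>F n in sequentially. indicator {-real n<..<real n} t *\<^sub>R g t = g t"
        using eventually_ge_at_top[of N] by eventually_elim (use N in \<open>auto simp: indicator_def\<close>)
    qed
  qed (use assms in \<open>auto split: split_indicator\<close>)
  then show ?thesis
    by (simp add: interval_lebesgue_integral_def set_lebesgue_integral_def einterval_eq)
qed

text \<open>The cutoff at \<open>x\<close> is the mass that a distribution on \<open>[-r, r]\<close> gives to
  \<open>(x - 2 r, x + 2 r]\<close>; Levy inversion writes it as a Fourier integral.\<close>

lemma exists_cutoff_as_Fourier_integral:
  fixes r :: real and p :: nat
  assumes "0 < r"
  shows "\<exists>w :: real \<Rightarrow> complex. w \<in> borel_measurable borel \<and>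
    integrable lborel (\<lambda>t. (1 + \<bar>t\<bar>) ^ p *\<^sub>R w t) \<and>
    (\<forall>x. \<bar>x\<bar> < r \<longrightarrow> (CLBINT t. w t * iexp (- (t * x))) = 1) \<and>
    (\<forall>x. \<bar>x\<bar> > 3 * r \<longrightarrow> (CLBINT t. w t * iexp (- (t * x))) = 0)"
proof -
  obtain M C where M: "real_distribution M" "AE x in M. \<bar>x\<bar> \<le> r"
    and C: "\<And>t. t \<noteq> 0 \<Longrightarrow> norm (char M t) \<le> C / \<bar>t\<bar> ^ (p + 2)"
    using exists_distribution_with_char_decay[OF assms] by blast
  interpret real_distribution M by fact
  \<comment> \<open>This is the Levy integrand for the window from \<open>- 2 * r\<close> to
    \<open>2 * r\<close>; moving the window to be centred at \<open>x\<close> multiplies it by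
    \<open>iexp (- (t * x))\<close>. Division by zero makes \<open>w 0 = 0\<close>, which affects
    only a single point.\<close>
  define w where "w t = 1 / (2 * pi) * ((iexp (t * (2 * r)) - iexp (t * (- 2 * r))) / (\<i> * t)) * char M t" for t
  have w_measurable [measurable]: "w \<in> borel_measurable borel"
    unfolding w_def by measurable
  \<comment> \<open>The difference quotient is at most the length \<open>4 * r\<close> of the
    window, so \<open>w\<close> inherits the decay of \<open>char M\<close>.\<close>
  have bnd: "norm (w t) \<le> 4 * r * norm (char M t)" for t
  proof (cases "t = 0")
    case False
    have "norm (w t) = 1 / (2 * pi) * norm ((iexp (t * (2 * r)) - iexp (t * (- 2 * r))) / (\<i> * t)) * norm (char M t)"
      by (simp add: w_def norm_mult norm_divide)
    also have "\<dots> \<le> 1 * (2 * r - (- 2 * r)) * norm (char M t)"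
      using assms False pi_ge_two
      by (intro mult_right_mono mult_mono Levy_Inversion_aux2) (auto)
    finally show ?thesis by simp
  qed (use assms in \<open>simp add: w_def\<close>)
  have int: "integrable lborel (\<lambda>t. (1 + \<bar>t\<bar>) ^ k *\<^sub>R w t)" if "k = p \<or> k = 0" for k
  proof -
    have "integrable lborel (\<lambda>t. (1 + \<bar>t\<bar>) ^ p *\<^sub>R w t)"
    proof (rule integrable_power_weight)
      show "norm (w t) \<le> 4 * r" for t
      proof -
        have "4 * r * norm (char M t) \<le> 4 * r * 1"
          using assms by (intro mult_left_mono cmod_char_le_1) auto
        with bnd[of t] show ?thesis by simp
      qed
      show "norm (w t) \<le> (4 * r * C) / \<bar>t\<bar> ^ (p + 2)" if "t \<noteq> 0" for t
        using order_trans[OF bnd[of t] mult_left_mono[OF C[OF that], of "4 * r"]] assms by simp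
    qed measurable
    moreover from this have "integrable lborel w"
    proof (rule Bochner_Integration.integrable_bound)
      have "1 * norm (w t) \<le> (1 + \<bar>t\<bar>) ^ p * norm (w t)" for t
        by (intro mult_right_mono) auto
      then show "AE t in lborel. norm (w t) \<le> norm ((1 + \<bar>t\<bar>) ^ p *\<^sub>R w t)"
        by (intro AE_I2) simp
    qed measurable
    ultimately show ?thesis using that by auto
  qed
  have inv: "(CLBINT t. w t * iexp (- (t * x))) = of_real (measure M {x - 2 * r<..x + 2 * r})"
    if "measure M {x - 2 * r} = 0" "measure M {x + 2 * r} = 0" for x
  proof -
    let ?g = "\<lambda>t. w t * iexp (- (t * x))"
    have "integrable lborel w" using int[of 0] by simp
    then have "integrable lborel ?g"
      by (rule Bochner_Integration.integrable_bound) (auto simp: norm_mult)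
    then have "(\<lambda>n::nat. CLBINT t=-real n..real n. ?g t) \<longlonglongrightarrow> (CLBINT t. ?g t)"
      by (rule tendsto_symmetric_interval_integral)
    moreover have "(\<lambda>n::nat. CLBINT t=-real n..real n. ?g t) \<longlonglongrightarrow> of_real (measure M {x - 2 * r<..x + 2 * r})"
    proof -
      have eq: "?g t = 1 / (2 * pi) * ((iexp (- (t * (x - 2 * r))) - iexp (- (t * (x + 2 * r)))) / (\<i> * t) * char M t)" for t
        by (simp add: w_def algebra_simps diff_divide_distrib flip: exp_add)
      have "x - 2 * r \<le> x + 2 * r" using assms by simp
      from Levy_Inversion[OF this that] show ?thesis
        by (simp only: eq interval_lebesgue_integral_mult_right of_int_minus of_int_of_nat_eq)
    qed
    ultimately show ?thesis by (rule LIMSEQ_unique)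
  qed
  have null: "measure M A = 0" if "A \<in> sets borel" "A \<inter> {-r..r} = {}" for A
  proof -
    have "AE x in M. x \<notin> A"
      using M(2) by eventually_elim (use that in \<open>force simp: disjoint_iff abs_le_iff\<close>)
    then show ?thesis using that by (simp add: AE_iff_measurable[OF _ refl] measure_def)
  qed
  \<comment> \<open>For \<bar>x\<bar> < r the window contains \<open>[-r, r]\<close> in its
    interior, and for \<bar>x\<bar> > 3 r even the closed window misses \<open>[-r, r]\<close>. In
    both cases the endpoints lie outside \<open>[-r, r]\<close> and so carry no mass, as inversion
    demands.\<close>
  have one: "(CLBINT t. w t * iexp (- (t * x))) = 1" if "\<bar>x\<bar> < r" for x
  proof -
    have "AE y in M. y \<in> {x - 2 * r<..x + 2 * r}"
      using M(2) by eventually_elim (use that in auto)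
    then have "measure M {x - 2 * r<..x + 2 * r} = 1"
      by (simp add: prob_eq_1)
    moreover have "measure M {x - 2 * r} = 0" "measure M {x + 2 * r} = 0"
      using that by (auto intro!: null)
    ultimately show ?thesis using inv[of x] by simp
  qed
  have zero: "(CLBINT t. w t * iexp (- (t * x))) = 0" if "\<bar>x\<bar> > 3 * r" for x
  proof -
    have "measure M {x - 2 * r<..x + 2 * r} = 0" "measure M {x - 2 * r} = 0" "measure M {x + 2 * r} = 0"
      using that by (auto intro!: null)
    then show ?thesis using inv[of x] by simp
  qed
  have int_p: "integrable lborel (\<lambda>t. (1 + \<bar>t\<bar>) ^ p *\<^sub>R w t)"
    by (rule int) simp
  show ?thesis
  proof (intro exI[of _ w] conjI allI impI)
    show "w \<in> borel_measurable borel" by (rule w_measurable)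
    show "integrable lborel (\<lambda>t. (1 + \<bar>t\<bar>) ^ p *\<^sub>R w t)" by (rule int_p)
  qed (rule one zero, assumption)+
qed

section \<open>Multipliers preserving Fourier decay\<close>

locale euclidean_finite_measure = finite_measure M for M :: "'a::euclidean_space measure" +
  assumes sets_borel [simp, measurable_cong]: "sets M = sets borel"

lemma euclidean_finite_measure_iff:
  "euclidean_finite_measure M \<longleftrightarrow> finite_borel_measure M"
  by (simp add: euclidean_finite_measure_def euclidean_finite_measure_axioms_def finite_borel_measure_def)

context euclidean_finite_measure
begin

lemma space_UNIV [simp]: "space M = UNIV"
  using sets_eq_imp_space_eq[OF sets_borel] by simp

definition weighted_fourier :: "('a \<Rightarrow> complex) \<Rightarrow> 'a \<Rightarrow> complex" where
  "weighted_fourier h \<xi> = (CLINT x | M. h x * iexp (- (2 * pi * (\<xi> \<bullet> x))))"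

text \<open>The weight \<open>1 + norm \<xi>\<close> has no singularity, which matters because
  frequency shifts move points across the origin. Measurability and boundedness are included so that
  the transform of the product with a multiplier is again a genuine integral.\<close>

definition weighted_decay :: "real \<Rightarrow> ('a \<Rightarrow> complex) \<Rightarrow> bool" where
  "weighted_decay s h \<longleftrightarrow> h \<in> borel_measurable borel \<and> bounded (range h) \<and>
    (\<exists>C. \<forall>\<xi>. norm (weighted_fourier h \<xi>) \<le> C * (1 + norm \<xi>) powr (- s / 2))"

text \<open>Quantifying over all \<open>h\<close>, rather than taking \<open>h = 1\<close> only,
  lets multipliers be applied one after another, which gives closure under products.\<close>

definition decay_multiplier :: "real \<Rightarrow> ('a \<Rightarrow> complex) \<Rightarrow> bool" where
  "decay_multiplier s \<phi> \<longleftrightarrow> (\<forall>h. weighted_decay s h \<longrightarrow> weighted_decay s (\<lambda>x. \<phi> x * h x))"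

lemma integrable_weight:
  assumes "h \<in> borel_measurable borel" "bounded (range h)"
  shows "integrable M (\<lambda>x. h x * iexp (- (2 * pi * (\<xi> \<bullet> x))))"
proof -
  obtain B where "\<And>x. norm (h x) \<le> B"
    using assms(2) by (auto simp: bounded_iff)
  moreover have [measurable]: "h \<in> borel_measurable borel" by fact
  ultimately show ?thesis
    by (intro integrable_const_bound[of _ B]) (auto simp: norm_mult)
qed

lemma weighted_decay_diff:
  assumes "weighted_decay s f" "weighted_decay s g"
  shows "weighted_decay s (\<lambda>x. f x - g x)"
proof -
  from assms obtain C D where
    C: "\<And>\<xi>. norm (weighted_fourier f \<xi>) \<le> C * (1 + norm \<xi>) powr (- s / 2)" and
    D: "\<And>\<xi>. norm (weighted_fourier g \<xi>) \<le> D * (1 + norm \<xi>) powr (- s / 2)"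
    and m: "f \<in> borel_measurable borel" "bounded (range f)" "g \<in> borel_measurable borel" "bounded (range g)"
    by (auto simp: weighted_decay_def)
  have "norm (weighted_fourier (\<lambda>x. f x - g x) \<xi>) \<le> (C + D) * (1 + norm \<xi>) powr (- s / 2)" for \<xi>
  proof -
    have "weighted_fourier (\<lambda>x. f x - g x) \<xi> = weighted_fourier f \<xi> - weighted_fourier g \<xi>"
      unfolding weighted_fourier_def left_diff_distrib
      by (intro Bochner_Integration.integral_diff integrable_weight m)
    then show ?thesis
      using norm_triangle_ineq4[of "weighted_fourier f \<xi>" "weighted_fourier g \<xi>"] C[of \<xi>] D[of \<xi>]
      by (simp add: distrib_right)
  qed
  then show ?thesis
    using m by (auto simp: weighted_decay_def intro!: bounded_minus_comp)
qed

lemma decay_multiplier_one_minus: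
  "decay_multiplier s \<phi> \<Longrightarrow> decay_multiplier s (\<lambda>x. 1 - \<phi> x)"
  by (auto simp: decay_multiplier_def left_diff_distrib intro!: weighted_decay_diff)

lemma decay_multiplier_prod:
  assumes "finite I" "\<And>i. i \<in> I \<Longrightarrow> decay_multiplier s (\<phi> i)"
  shows "decay_multiplier s (\<lambda>x. \<Prod>i\<in>I. \<phi> i x)"
  using assms
  by (induction I rule: finite_induct) (auto simp: decay_multiplier_def mult.assoc)

text \<open>Multiplication by \<open>iexp (- (t * (x \<bullet> v)))\<close> shifts the frequency by
  \<open>(t / (2 * pi)) *\<^sub>R v\<close>, so Fubini writes the new transform as an integral of
  shifted old ones against \<open>w\<close>. A shift costs at most
  \<open>(1 + \<bar>t\<bar>) ^ p\<close>, and the weighted integrability of \<open>w\<close> keeps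
  the total cost finite.\<close>

lemma decay_multiplier_Fourier_integral:
  fixes w :: "real \<Rightarrow> complex" and v :: 'a
  assumes s: "0 \<le> s" "s / 2 \<le> real p" and v: "norm v \<le> 1"
    and w [measurable]: "w \<in> borel_measurable borel"
    and int: "integrable lborel (\<lambda>t. (1 + \<bar>t\<bar>) ^ p *\<^sub>R w t)"
  shows "decay_multiplier s (\<lambda>x. CLBINT t. w t * iexp (- (t * (x \<bullet> v))))"
  unfolding decay_multiplier_def
proof (intro allI impI)
  fix h assume h: "weighted_decay s h"
  then have hm [measurable]: "h \<in> borel_measurable borel" and "bounded (range h)"
    by (auto simp: weighted_decay_def)
  then obtain B where B: "\<And>x. norm (h x) \<le> B"
    by (auto simp: bounded_iff)
  have B0: "0 \<le> B" using order_trans[OF norm_ge_zero B] .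
  from h obtain C where C: "\<And>\<xi>. norm (weighted_fourier h \<xi>) \<le> C * (1 + norm \<xi>) powr (- s / 2)"
    by (auto simp: weighted_decay_def)
  have C0: "0 \<le> C" using order_trans[OF norm_ge_zero C[of 0]] by simp
  have int_w: "integrable lborel w"
  proof (rule Bochner_Integration.integrable_bound[OF int])
    have "1 * norm (w t) \<le> (1 + \<bar>t\<bar>) ^ p * norm (w t)" for t
      by (intro mult_right_mono) auto
    then show "AE t in lborel. norm (w t) \<le> norm ((1 + \<bar>t\<bar>) ^ p *\<^sub>R w t)"
      by (intro AE_I2) simp
  qed measurable
  define \<phi> where "\<phi> x = (CLBINT t. w t * iexp (- (t * (x \<bullet> v))))" for x
  define J where "J = (LBINT t. norm ((1 + \<bar>t\<bar>) ^ p *\<^sub>R w t))"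
  have \<phi>_m [measurable]: "\<phi> \<in> borel_measurable borel"
    unfolding \<phi>_def by measurable
  have \<phi>_bound: "norm (\<phi> x) \<le> (LBINT t. norm (w t))" for x
    unfolding \<phi>_def by (rule order_trans[OF integral_norm_bound]) (simp add: norm_mult)
  interpret P: pair_sigma_finite lborel M ..
  have "norm (weighted_fourier (\<lambda>x. \<phi> x * h x) \<xi>) \<le> (J * C) * (1 + norm \<xi>) powr (- s / 2)" for \<xi>
  proof -
    define \<eta> where "\<eta> t = \<xi> + (t / (2 * pi)) *\<^sub>R v" for t
    let ?f = "\<lambda>t x. w t * (h x * iexp (- (2 * pi * (\<eta> t \<bullet> x))))"
    have \<eta>_m [measurable]: "\<eta> \<in> borel_measurable borel" unfolding \<eta>_def by measurable
    \<comment> \<open>The integrand has modulus \<open>norm (w t) * norm (h x)\<close>;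
      \<open>h\<close> is bounded by \<open>B\<close> and \<open>M\<close> is finite, so the inner
      integral is dominated by a multiple of the integrable \<open>norm (w t)\<close>.\<close>
    have int_f: "integrable (lborel \<Otimes>\<^sub>M M) (case_prod ?f)"
    proof (rule P.Fubini_integrable)
      show "integrable lborel (\<lambda>t. LINT x|M. norm (case (t, x) of (t, x) \<Rightarrow> ?f t x))"
      proof (rule Bochner_Integration.integrable_bound)
        show "integrable lborel (\<lambda>t. norm (w t) * (B * measure M UNIV))"
          using int_w by auto
        show "AE t in lborel. norm (LINT x|M. norm (case (t, x) of (t, x) \<Rightarrow> ?f t x)) \<le> norm (norm (w t) * (B * measure M UNIV))"
        proof (rule AE_I2)
          fix t
          have "(LINT x|M. norm (w t) * norm (h x)) \<le> (LINT x|M. norm (w t) * B)"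
            by (intro integral_mono integrable_mult_right integrable_const mult_left_mono B norm_ge_zero
                integrable_const_bound[of _ B]) (use B in auto)
          then show "norm (LINT x|M. norm (case (t, x) of (t, x) \<Rightarrow> ?f t x)) \<le> norm (norm (w t) * (B * measure M UNIV))"
            using B0 by (simp add: norm_mult mult_ac)
        qed
      qed measurable
    qed (use integrable_weight[OF hm \<open>bounded (range h)\<close>] in auto)
    have "weighted_fourier (\<lambda>x. \<phi> x * h x) \<xi> = (CLINT x | M. (CLBINT t. ?f t x))"
      unfolding weighted_fourier_def \<phi>_def
    proof (intro Bochner_Integration.integral_cong refl)
      fix x
      have f_eq: "?f t x = w t * iexp (- (t * (x \<bullet> v))) * (h x * iexp (- (2 * pi * (\<xi> \<bullet> x))))" for t
      proof -
        have "2 * pi * (\<eta> t \<bullet> x) = t * (x \<bullet> v) + 2 * pi * (\<xi> \<bullet> x)"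
          by (simp add: \<eta>_def inner_add_left inner_commute[of v] field_simps)
        then have "iexp (- (2 * pi * (\<eta> t \<bullet> x))) = iexp (- (t * (x \<bullet> v))) * iexp (- (2 * pi * (\<xi> \<bullet> x)))"
          by (simp add: algebra_simps flip: exp_add)
        then show ?thesis by simp
      qed
      then show "(CLBINT t. w t * iexp (- (t * (x \<bullet> v)))) * h x * iexp (- (2 * pi * (\<xi> \<bullet> x))) = (CLBINT t. ?f t x)"
        unfolding f_eq integral_mult_left_zero by (simp only: mult.assoc)
    qed
    also have "\<dots> = (CLBINT t. (CLINT x | M. ?f t x))"
      by (rule P.Fubini_integral[OF int_f])
    also have "\<dots> = (CLBINT t. w t * weighted_fourier h (\<eta> t))"
      by (simp add: weighted_fourier_def)
    finally have eq: "weighted_fourier (\<lambda>x. \<phi> x * h x) \<xi> = (CLBINT t. w t * weighted_fourier h (\<eta> t))" .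
    \<comment> \<open>Peetre's inequality: a frequency shift by \<open>t\<close> costs only a factor polynomial in \<open>t\<close>.\<close>
    have Peetre: "(1 + norm (\<eta> t)) powr (- s / 2) \<le> (1 + \<bar>t\<bar>) ^ p * (1 + norm \<xi>) powr (- s / 2)" for t
    proof -
      have "norm ((t / (2 * pi)) *\<^sub>R v) \<le> \<bar>t\<bar> * 1"
      proof -
        have "\<bar>t\<bar> / (2 * pi) \<le> \<bar>t\<bar> / 1" using pi_ge_two by (intro divide_left_mono) auto
        from mult_mono[OF this v] show ?thesis by simp
      qed
      moreover have "norm \<xi> \<le> norm (\<eta> t) + norm ((t / (2 * pi)) *\<^sub>R v)"
        unfolding \<eta>_def using norm_triangle_ineq4[of "\<xi> + (t / (2 * pi)) *\<^sub>R v" "(t / (2 * pi)) *\<^sub>R v"] by simp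
      moreover have "0 \<le> norm (\<eta> t) * \<bar>t\<bar>" by simp
      ultimately have "1 + norm \<xi> \<le> 1 + \<bar>t\<bar> + norm (\<eta> t) + norm (\<eta> t) * \<bar>t\<bar>"
        by linarith
      then have "1 + norm \<xi> \<le> (1 + \<bar>t\<bar>) * (1 + norm (\<eta> t))"
        by (simp add: algebra_simps)
      then have "(1 + norm \<xi>) powr (s / 2) \<le> (1 + \<bar>t\<bar>) powr (s / 2) * (1 + norm (\<eta> t)) powr (s / 2)"
        using s(1) by (subst powr_mult[symmetric]) (auto intro!: powr_mono2)
      also have "\<dots> \<le> (1 + \<bar>t\<bar>) ^ p * (1 + norm (\<eta> t)) powr (s / 2)"
      proof (intro mult_right_mono)
        have "(1 + \<bar>t\<bar>) powr (s / 2) \<le> (1 + \<bar>t\<bar>) powr (real p)"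
          using s(2) by (intro powr_mono) auto
        then show "(1 + \<bar>t\<bar>) powr (s / 2) \<le> (1 + \<bar>t\<bar>) ^ p" by (simp add: powr_realpow)
      qed auto
      finally have "(1 + norm \<xi>) powr (s / 2) \<le> (1 + \<bar>t\<bar>) ^ p * (1 + norm (\<eta> t)) powr (s / 2)" .
      moreover have "0 < (1 + norm \<xi>) powr (s / 2)" "0 < (1 + norm (\<eta> t)) powr (s / 2)"
        by (simp_all add: add_pos_nonneg less_imp_neq[symmetric])
      ultimately show ?thesis by (simp add: powr_minus field_simps)
    qed
    have "norm (weighted_fourier (\<lambda>x. \<phi> x * h x) \<xi>) \<le> (LBINT t. norm (w t * weighted_fourier h (\<eta> t)))"
      unfolding eq by (rule integral_norm_bound)
    also have "\<dots> \<le> (LBINT t. norm ((1 + \<bar>t\<bar>) ^ p *\<^sub>R w t) * (C * (1 + norm \<xi>) powr (- s / 2)))"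
    proof (rule integral_mono_AE')
      show "AE t in lborel. norm (w t * weighted_fourier h (\<eta> t)) \<le> norm ((1 + \<bar>t\<bar>) ^ p *\<^sub>R w t) * (C * (1 + norm \<xi>) powr (- s / 2))"
      proof (rule AE_I2)
        fix t
        have "norm (weighted_fourier h (\<eta> t)) \<le> C * ((1 + \<bar>t\<bar>) ^ p * (1 + norm \<xi>) powr (- s / 2))"
          using C[of "\<eta> t"] mult_left_mono[OF Peetre[of t] C0] by linarith
        from mult_left_mono[OF this norm_ge_zero[of "w t"]]
        show "norm (w t * weighted_fourier h (\<eta> t)) \<le> norm ((1 + \<bar>t\<bar>) ^ p *\<^sub>R w t) * (C * (1 + norm \<xi>) powr (- s / 2))"
          by (simp add: norm_mult mult_ac)
      qed
      show "integrable lborel (\<lambda>t. norm ((1 + \<bar>t\<bar>) ^ p *\<^sub>R w t) * (C * (1 + norm \<xi>) powr (- s / 2)))"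
        using int by (intro integrable_mult_left integrable_norm)
    qed (use C0 in auto)
    also have "\<dots> = (J * C) * (1 + norm \<xi>) powr (- s / 2)"
      unfolding J_def integral_mult_left_zero by (simp only: mult.assoc)
    finally show ?thesis .
  qed
  moreover have "bounded (range (\<lambda>x. \<phi> x * h x))"
    using \<phi>_bound B B0
    by (auto simp: bounded_iff norm_mult intro!: exI[of _ "(LBINT t. norm (w t)) * B"] mult_mono)
  ultimately show "weighted_decay s (\<lambda>x. (CLBINT t. w t * iexp (- (t * (x \<bullet> v)))) * h x)"
    unfolding weighted_decay_def \<phi>_def[symmetric] by auto
qed

text \<open>The two weights are comparable off the unit ball, where \<open>1 + norm \<xi>\<close> is
  at most \<open>2 * norm \<xi>\<close>. On the unit ball the total mass bounds the transform, and
  \<open>1 + norm \<xi>\<close> is at most 2. Both cases account for the factor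
  \<open>2 powr (s / 2)\<close>.\<close>

lemma weighted_decay_one_iff:
  assumes "0 \<le> s"
  shows "weighted_decay s (\<lambda>x. 1) \<longleftrightarrow> fourier_decay M s"
proof -
  have eq: "fourier_measure M \<xi> = weighted_fourier (\<lambda>x. 1) \<xi>" for \<xi>
    unfolding fourier_measure_def weighted_fourier_def
    by (intro Bochner_Integration.integral_cong refl) (simp add: mult_ac)
  show ?thesis
  proof
    assume "weighted_decay s (\<lambda>x. 1)"
    then obtain C where C: "\<And>\<xi>. norm (weighted_fourier (\<lambda>x. 1) \<xi>) \<le> C * (1 + norm \<xi>) powr (- s / 2)"
      by (auto simp: weighted_decay_def)
    have C0: "0 \<le> C" using order_trans[OF norm_ge_zero C[of 0]] by simp
    have "norm (fourier_measure M \<xi>) \<le> C * norm \<xi> powr (- s / 2)" if "\<xi> \<noteq> 0" for \<xi>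
    proof -
      have "(1 + norm \<xi>) powr (- s / 2) \<le> norm \<xi> powr (- s / 2)"
        using that assms by (intro powr_mono2') auto
      from mult_left_mono[OF this C0] C[of \<xi>] show ?thesis unfolding eq by linarith
    qed
    then show "fourier_decay M s" by (auto simp: fourier_decay_def)
  next
    assume "fourier_decay M s"
    then obtain C where C: "\<And>\<xi>. \<xi> \<noteq> 0 \<Longrightarrow> norm (weighted_fourier (\<lambda>x. 1) \<xi>) \<le> C * norm \<xi> powr (- s / 2)"
      unfolding fourier_decay_def eq by auto
    define m where "m = \<bar>C\<bar> + measure M UNIV"
    have m0: "0 \<le> m" by (simp add: m_def)
    have triv: "norm (weighted_fourier (\<lambda>x. 1) \<xi>) \<le> measure M UNIV" for \<xi>
      unfolding weighted_fourier_def
      by (rule order_trans[OF integral_norm_bound]) simp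
    have "norm (weighted_fourier (\<lambda>x. 1) \<xi>) \<le> (m * 2 powr (s / 2)) * (1 + norm \<xi>) powr (- s / 2)" for \<xi>
    proof (cases "norm \<xi> \<le> 1")
      case True
      have "norm (weighted_fourier (\<lambda>x. 1) \<xi>) \<le> m * 1"
        using triv[of \<xi>] by (simp add: m_def)
      also have "1 = 2 powr (s / 2) * 2 powr (- s / 2)"
        by (simp flip: powr_add)
      also have "m * \<dots> \<le> m * (2 powr (s / 2) * (1 + norm \<xi>) powr (- s / 2))"
        using True assms m0 by (intro mult_left_mono powr_mono2') (auto simp: add_pos_nonneg)
      finally show ?thesis by (simp add: mult.assoc)
    next
      case False
      then have "norm (weighted_fourier (\<lambda>x. 1) \<xi>) \<le> C * norm \<xi> powr (- s / 2)"
        by (intro C) auto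
      also have "\<dots> \<le> m * norm \<xi> powr (- s / 2)"
        by (intro mult_right_mono) (auto simp: m_def add_increasing2)
      also have "\<dots> \<le> m * ((1 + norm \<xi>) / 2) powr (- s / 2)"
        using False assms m0 by (intro mult_left_mono powr_mono2') auto
      also have "\<dots> = (m * 2 powr (s / 2)) * (1 + norm \<xi>) powr (- s / 2)"
        by (simp add: powr_divide powr_minus field_simps)
      finally show ?thesis .
    qed
    then show "weighted_decay s (\<lambda>x. 1)" by (auto simp: weighted_decay_def)
  qed
qed

text \<open>Products of coordinate cutoffs give bumps \<open>f a\<close>, each 1 on a small ball
  around \<open>a\<close> and 0 off a larger cube. By compactness finitely many of these balls cover
  \<open>K\<close>. The combination \<open>1 - (\<Prod>a\<in>T. 1 - f a x)\<close> is 1 as soon as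
  one bump is 1, and 0 where all bumps vanish.\<close>

lemma exists_decay_multiplier_cutoff:
  assumes s: "0 \<le> s" "s \<le> real DIM('a)" and K: "compact K" and L: "closed L" and KL: "K \<inter> L = {}"
  shows "\<exists>\<phi>. decay_multiplier s \<phi> \<and> (\<forall>x\<in>K. \<phi> x = 1) \<and> (\<forall>x\<in>L. \<phi> x = 0)"
proof -
  obtain d where d: "0 < d" "\<And>x y. x \<in> K \<Longrightarrow> y \<in> L \<Longrightarrow> d \<le> dist x y"
    using separate_compact_closed[OF K L KL] by blast
  \<comment> \<open>If all coordinates of \<open>x - a\<close> were at most \<open>3 * r\<close> in
    modulus, its norm would be at most \<open>3 * d / 4\<close>, by comparison with the sum of the
    coordinates. Hence each bump centred in \<open>K\<close> vanishes on \<open>L\<close>.\<close>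
  define r where "r = d / (4 * DIM('a))"
  have r: "0 < r" using d by (simp add: r_def)
  obtain w :: "real \<Rightarrow> complex" where w: "w \<in> borel_measurable borel"
    and int_w: "integrable lborel (\<lambda>t. (1 + \<bar>t\<bar>) ^ DIM('a) *\<^sub>R w t)"
    and one: "\<And>x. \<bar>x\<bar> < r \<Longrightarrow> (CLBINT t. w t * iexp (- (t * x))) = 1"
    and zero: "\<And>x. \<bar>x\<bar> > 3 * r \<Longrightarrow> (CLBINT t. w t * iexp (- (t * x))) = 0"
    using exists_cutoff_as_Fourier_integral[OF r] by blast
  define f where "f a x = (\<Prod>i\<in>Basis. CLBINT t. w t * iexp (- (t * ((x - a) \<bullet> i))))" for a x :: 'a
  have mult_f: "decay_multiplier s (f a)" for a
    unfolding f_def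
  proof (intro decay_multiplier_prod finite_Basis)
    fix i :: 'a assume i: "i \<in> Basis"
    \<comment> \<open>Translating the cutoff by \<open>a\<close> only multiplies its weight by a
      factor of modulus 1, so integrability is unaffected.\<close>
    let ?w = "\<lambda>t. w t * iexp (t * (a \<bullet> i))"
    have [measurable]: "w \<in> borel_measurable borel" by fact
    have "decay_multiplier s (\<lambda>x. CLBINT t. ?w t * iexp (- (t * (x \<bullet> i))))"
    proof (rule decay_multiplier_Fourier_integral)
      show "integrable lborel (\<lambda>t. (1 + \<bar>t\<bar>) ^ DIM('a) *\<^sub>R ?w t)"
        by (rule Bochner_Integration.integrable_bound[OF int_w]) (auto simp: norm_mult)
    qed (use s i in auto)
    moreover have "?w t * iexp (- (t * (x \<bullet> i))) = w t * iexp (- (t * ((x - a) \<bullet> i)))" for t x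
      by (simp add: algebra_simps inner_diff_left flip: exp_add)
    ultimately show "decay_multiplier s (\<lambda>x. CLBINT t. w t * iexp (- (t * ((x - a) \<bullet> i))))"
      by (simp only:)
  qed
  have "K \<subseteq> (\<Union>a\<in>K. ball a r)" using r by auto
  from compactE_image[OF K open_ball this]
  obtain T where T: "T \<subseteq> K" "finite T" "K \<subseteq> (\<Union>a\<in>T. ball a r)" by blast
  define \<phi> where "\<phi> x = 1 - (\<Prod>a\<in>T. 1 - f a x)" for x
  have "decay_multiplier s \<phi>"
    unfolding \<phi>_def
    by (intro decay_multiplier_one_minus decay_multiplier_prod mult_f T)
  moreover have "\<phi> x = 1" if "x \<in> K" for x
  proof -
    have "x \<in> (\<Union>a\<in>T. ball a r)" using T(3) that by blast
    then obtain a where a: "a \<in> T" "dist a x < r" by (auto simp only: UN_iff mem_ball)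
    have "f a x = 1"
      unfolding f_def
    proof (intro prod.neutral ballI one)
      fix i :: 'a assume "i \<in> Basis"
      then have "\<bar>(x - a) \<bullet> i\<bar> \<le> norm (x - a)" by (rule Basis_le_norm)
      then show "\<bar>(x - a) \<bullet> i\<bar> < r" using a by (simp add: dist_norm norm_minus_commute)
    qed
    then show ?thesis using a T by (auto simp: \<phi>_def)
  qed
  moreover have "\<phi> x = 0" if "x \<in> L" for x
  proof -
    have "f a x = 0" if "a \<in> T" for a
    proof -
      have "\<exists>i\<in>Basis. \<bar>(x - a) \<bullet> i\<bar> > 3 * r"
      proof (rule ccontr)
        assume "\<not> ?thesis"
        then have "(\<Sum>i\<in>Basis. \<bar>(x - a) \<bullet> i\<bar>) \<le> of_nat DIM('a) * (3 * r)"
          by (intro sum_bounded_above) (auto simp: not_less)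
        then have "norm (x - a) \<le> of_nat DIM('a) * (3 * r)"
          using norm_le_l1[of "x - a"] by linarith
        also have "\<dots> < d" using d by (simp add: r_def)
        finally show False
          using d(2)[of a x] that T \<open>x \<in> L\<close> by (auto simp: dist_norm norm_minus_commute)
      qed
      then obtain i where "i \<in> Basis" "\<bar>(x - a) \<bullet> i\<bar> > 3 * r" by blast
      then show ?thesis
        unfolding f_def by (intro prod_zero finite_Basis bexI[of _ i] zero)
    qed
    then show ?thesis by (simp add: \<phi>_def)
  qed
  ultimately show ?thesis by blast
qed

end

section \<open>Supports and sums of measures\<close>

text \<open>The complement of the support is the union of all open null sets. Lindelof's theorem
  reduces it to a countable union, which is null.\<close>

lemma AE_in_measure_support:
  fixes M :: "'a::second_countable_topology measure"
  assumes "sets M = sets borel"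
  shows "AE x in M. x \<in> measure_support M"
proof -
  let ?F = "{U. open U \<and> emeasure M U = 0}"
  obtain F where F: "F \<subseteq> ?F" "countable F" "\<Union>F = \<Union>?F"
    using Lindelof[of ?F] by auto
  have "(\<Union>U\<in>F. U) \<in> null_sets M"
    using F assms by (intro null_sets_UN') (auto intro!: null_setsI)
  then have "\<Union>?F \<in> null_sets M" using F by simp
  then have "AE x in M. x \<notin> \<Union>?F" by (rule AE_not_in)
  then show ?thesis
    by eventually_elim (auto simp: measure_support_def zero_less_iff_neq_zero)
qed

section \<open>Integration against a sum of measures\<close>

lemma nn_integral_add_measure:
  assumes sets: "sets M = sets N" and f: "f \<in> borel_measurable M"
  shows "(\<integral>\<^sup>+x. f x \<partial>add_measure M N) = (\<integral>\<^sup>+x. f x \<partial>M) + (\<integral>\<^sup>+x. f x \<partial>N)"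
proof -
  have sp: "space M = space N" by (rule sets_eq_imp_space_eq[OF sets])
  have mD: "u \<in> borel_measurable (add_measure M N)" and mN: "u \<in> borel_measurable N"
    if "u \<in> borel_measurable M" for u :: "'a \<Rightarrow> ennreal"
    using that measurable_cong_sets[OF sets refl, of borel]
      measurable_cong_sets[OF sets_add_measure[of M N] refl, of borel] by blast+
  show ?thesis
    using f
  proof induct
    case (cong f g)
    have "integral\<^sup>N L f = integral\<^sup>N L g" if "space L = space M" for L
      using that by (intro nn_integral_cong) (simp add: cong(3))
    then show ?case using cong(4) sp by simp
  next
    case (set A)
    then show ?case using sets by (simp add: emeasure_add_measure)
  next
    case (mult u c)
    then show ?case by (simp add: nn_integral_cmult mD mN distrib_left)
  next
    case (add u v)
    then show ?case by (simp add: nn_integral_add mD mN ac_simps)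
  next
    case (seq U)
    then show ?case
      by (simp add: nn_integral_monotone_convergence_SUP image_comp mD mN ennreal_SUP_add incseq_nn_integral)
  qed
qed

lemma integral_add_measure:
  fixes f :: "'a \<Rightarrow> 'b::{banach, second_countable_topology}"
  assumes sets: "sets M = sets N" and "integrable M f" "integrable N f"
  shows "integral\<^sup>L (add_measure M N) f = integral\<^sup>L M f + integral\<^sup>L N f"
proof -
  have sp: "space M = space N" by (rule sets_eq_imp_space_eq[OF sets])
  have meas: "g \<in> borel_measurable (add_measure M N) \<longleftrightarrow> g \<in> borel_measurable M"
      "g \<in> borel_measurable N \<longleftrightarrow> g \<in> borel_measurable M" for g :: "'a \<Rightarrow> 'b"
    using measurable_cong_sets[OF sets refl, of borel]
      measurable_cong_sets[OF sets_add_measure[of M N] refl, of borel] by blast+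
  have int: "integrable (add_measure M N) g \<longleftrightarrow> integrable M g \<and> integrable N g" for g :: "'a \<Rightarrow> 'b"
    by (auto simp: integrable_iff_bounded meas nn_integral_add_measure[OF sets])
  have "integrable (add_measure M N) f" using assms by (simp add: int)
  then show ?thesis
  proof induct
    case (base A c)
    then show ?case using sets
      by (simp add: measure_def emeasure_add_measure enn2real_plus scaleR_add_left less_top sp)
  next
    case (add f g)
    then show ?case by (simp add: int)
  next
    case (lim f s)
    have f: "integrable M f" "integrable N f" using lim by (simp_all add: int)
    have s: "\<And>i. integrable M (s i)" "\<And>i. integrable N (s i)" using lim by (simp_all add: int)
    \<comment> \<open>The approximants of the induction rule are dominated by
      \<open>2 * norm (f x)\<close>, which is integrable for all three measures; additivity then
      passes to the limit.\<close>
    have conv: "(\<lambda>i. integral\<^sup>L M (s i)) \<longlonglongrightarrow> integral\<^sup>L M f" "(\<lambda>i. integral\<^sup>L N (s i)) \<longlonglongrightarrow> integral\<^sup>L N f"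
      "(\<lambda>i. integral\<^sup>L (add_measure M N) (s i)) \<longlonglongrightarrow> integral\<^sup>L (add_measure M N) f"
      using lim(1,3,4,5) f s
      by (auto intro!: integral_dominated_convergence[where w = "\<lambda>x. 2 * norm (f x)"] simp: sp)
    then show ?case
      using LIMSEQ_unique[OF conv(3)[unfolded lim(2)] tendsto_add[OF conv(1,2)]] by simp
  qed
qed

lemma finite_borel_measure_add_measure:
  assumes "finite_borel_measure M" "finite_borel_measure N"
  shows "finite_borel_measure (add_measure M N)"
proof -
  interpret M: finite_measure M using assms by (simp add: finite_borel_measure_def)
  interpret N: finite_measure N using assms by (simp add: finite_borel_measure_def)
  have sets: "sets M = sets N" using assms by (simp add: finite_borel_measure_def)
  have "finite_measure (add_measure M N)"
    by (rule finite_measureI)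
      (simp add: emeasure_add_measure[OF sets] sets_eq_imp_space_eq[OF sets])
  then show ?thesis using assms by (simp add: finite_borel_measure_def)
qed

section \<open>Fourier decay of a sum and of its summands\<close>

lemma fourier_measure_add_measure:
  assumes "finite_borel_measure M" "finite_borel_measure N"
  shows "fourier_measure (add_measure M N) \<xi> = fourier_measure M \<xi> + fourier_measure N \<xi>"
proof -
  interpret M: euclidean_finite_measure M using assms by (simp add: euclidean_finite_measure_iff)
  interpret N: euclidean_finite_measure N using assms by (simp add: euclidean_finite_measure_iff)
  have "integrable M (\<lambda>x. exp (- 2 * of_real pi * \<i> * of_real (\<xi> \<bullet> x)))"
    "integrable N (\<lambda>x. exp (- 2 * of_real pi * \<i> * of_real (\<xi> \<bullet> x)))"
    using M.integrable_weight[of "\<lambda>_. 1" \<xi>] N.integrable_weight[of "\<lambda>_. 1" \<xi>]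
    by (simp_all add: mult_ac)
  then show ?thesis
    unfolding fourier_measure_def by (intro integral_add_measure) simp_all
qed

lemma fourier_decay_add_measure:
  assumes "finite_borel_measure M" "finite_borel_measure N" "fourier_decay M s" "fourier_decay N s"
  shows "fourier_decay (add_measure M N) s"
proof -
  obtain C D where C: "\<And>\<xi>. \<xi> \<noteq> 0 \<Longrightarrow> norm (fourier_measure M \<xi>) \<le> C * norm \<xi> powr (- s / 2)"
    and D: "\<And>\<xi>. \<xi> \<noteq> 0 \<Longrightarrow> norm (fourier_measure N \<xi>) \<le> D * norm \<xi> powr (- s / 2)"
    using assms(3,4) by (auto simp: fourier_decay_def)
  have "norm (fourier_measure (add_measure M N) \<xi>) \<le> (C + D) * norm \<xi> powr (- s / 2)" if "\<xi> \<noteq> 0" for \<xi>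
    using C[OF that] D[OF that] norm_triangle_ineq[of "fourier_measure M \<xi>" "fourier_measure N \<xi>"]
    by (simp add: fourier_measure_add_measure[OF assms(1,2)] distrib_right)
  then show ?thesis by (auto simp: fourier_decay_def)
qed

text \<open>A cutoff \<phi> that is 1 on the support of \<open>M\<close> and 0 on that of
  \<open>N\<close> is 1 almost everywhere for \<open>M\<close> and 0 almost everywhere for
  \<open>N\<close>. Weighting the sum by \<phi> therefore recovers the transform of
  \<open>M\<close>, and \<phi> preserves decay.\<close>

lemma fourier_decay_add_measureD:
  fixes M N :: "'a::euclidean_space measure"
  assumes M: "finite_borel_measure M" and N: "finite_borel_measure N"
    and supp: "compact (measure_support M)" "compact (measure_support N)"
      "measure_support M \<inter> measure_support N = {}"
    and s: "0 \<le> s" "s \<le> real DIM('a)" and decay: "fourier_decay (add_measure M N) s"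
  shows "fourier_decay M s"
proof -
  interpret M: euclidean_finite_measure M using M by (simp add: euclidean_finite_measure_iff)
  interpret N: euclidean_finite_measure N using N by (simp add: euclidean_finite_measure_iff)
  interpret S: euclidean_finite_measure "add_measure M N"
    using finite_borel_measure_add_measure[OF M N] by (simp add: euclidean_finite_measure_iff)
  obtain \<phi> where \<phi>: "S.decay_multiplier s \<phi>"
    and one: "\<And>x. x \<in> measure_support M \<Longrightarrow> \<phi> x = 1"
    and zero: "\<And>x. x \<in> measure_support N \<Longrightarrow> \<phi> x = 0"
    using S.exists_decay_multiplier_cutoff[OF s supp(1) compact_imp_closed[OF supp(2)] supp(3)] by blast
  have "S.weighted_decay s (\<lambda>x. 1)"
    using decay s by (simp add: S.weighted_decay_one_iff)
  then have "S.weighted_decay s \<phi>"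
    using \<phi> by (force simp: S.decay_multiplier_def)
  then obtain C where C: "\<And>\<xi>. norm (S.weighted_fourier \<phi> \<xi>) \<le> C * (1 + norm \<xi>) powr (- s / 2)"
    and \<phi>_m [measurable]: "\<phi> \<in> borel_measurable borel" and \<phi>_b: "bounded (range \<phi>)"
    by (auto simp: S.weighted_decay_def)
  have "S.weighted_fourier \<phi> \<xi> = M.weighted_fourier (\<lambda>x. 1) \<xi>" for \<xi>
  proof -
    let ?e = "\<lambda>x. iexp (- (2 * pi * (\<xi> \<bullet> x)))"
    have "S.weighted_fourier \<phi> \<xi> = (CLINT x | M. \<phi> x * ?e x) + (CLINT x | N. \<phi> x * ?e x)"
      unfolding S.weighted_fourier_def
      by (intro integral_add_measure M.integrable_weight N.integrable_weight \<phi>_m \<phi>_b) simp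
    also have "(CLINT x | M. \<phi> x * ?e x) = (CLINT x | M. 1 * ?e x)"
    proof (rule integral_cong_AE)
      show "AE x in M. \<phi> x * ?e x = 1 * ?e x"
        using AE_in_measure_support[OF M.sets_borel] by eventually_elim (simp add: one)
    qed measurable
    also have "(CLINT x | N. \<phi> x * ?e x) = (CLINT x | N. 0)"
    proof (rule integral_cong_AE)
      show "AE x in N. \<phi> x * ?e x = 0"
        using AE_in_measure_support[OF N.sets_borel] by eventually_elim (simp add: zero)
    qed measurable
    finally show ?thesis by (simp add: M.weighted_fourier_def)
  qed
  with C have "M.weighted_decay s (\<lambda>x. 1)"
    by (auto simp: M.weighted_decay_def)
  then show ?thesis using s by (simp add: M.weighted_decay_one_iff)
qed

section \<open>From decay exponents to dimensions\<close>

lemma add_measure_commute: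
  "sets M = sets N \<Longrightarrow> add_measure M N = add_measure N M"
  by (rule measure_eqI) (simp_all add: emeasure_add_measure add.commute)

text \<open>Passing to the base \<open>1 + norm \<xi>\<close>, which is at least 1, makes the power
  monotone in its exponent; with base \<open>norm \<xi>\<close> this would fail near the
  origin.\<close>

lemma fourier_decay_antimono:
  fixes M :: "'a::euclidean_space measure"
  assumes M: "finite_borel_measure M" and s: "0 \<le> s'" "s' \<le> s" "fourier_decay M s"
  shows "fourier_decay M s'"
proof -
  interpret euclidean_finite_measure M using M by (simp add: euclidean_finite_measure_iff)
  have "weighted_decay s (\<lambda>x. 1)" using s by (simp add: weighted_decay_one_iff)
  then obtain C where C: "\<And>\<xi>. norm (weighted_fourier (\<lambda>x. 1) \<xi>) \<le> C * (1 + norm \<xi>) powr (- s / 2)"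
    by (auto simp: weighted_decay_def)
  have C0: "0 \<le> C" using order_trans[OF norm_ge_zero C[of 0]] by simp
  have "norm (weighted_fourier (\<lambda>x. 1) \<xi>) \<le> C * (1 + norm \<xi>) powr (- s' / 2)" for \<xi>
    by (rule order_trans[OF C]) (use s C0 in \<open>auto intro!: mult_left_mono powr_mono\<close>)
  then have "weighted_decay s' (\<lambda>x. 1)" by (auto simp: weighted_decay_def)
  then show ?thesis using s by (simp add: weighted_decay_one_iff)
qed

text \<open>Ensures that the set of exponents defining the dimension is nonempty, so that its
  supremum is meaningful.\<close>

lemma fourier_decay_zero:
  fixes M :: "'a::euclidean_space measure"
  assumes "finite_borel_measure M"
  shows "fourier_decay M 0"
proof -
  interpret euclidean_finite_measure M using assms by (simp add: euclidean_finite_measure_iff)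
  have "norm (fourier_measure M \<xi>) \<le> measure M UNIV" for \<xi>
    unfolding fourier_measure_def
    by (rule order_trans[OF integral_norm_bound]) (simp add: norm_exp)
  then show ?thesis by (auto simp: fourier_decay_def)
qed

text \<open>Two down-closed subsets of \<open>{0..d}\<close> are comparable by inclusion, so the
  intersection is the smaller of the two.\<close>

lemma Sup_Int_downclosed:
  fixes A B :: "real set"
  assumes "\<And>x y. x \<in> A \<Longrightarrow> 0 \<le> y \<Longrightarrow> y \<le> x \<Longrightarrow> y \<in> A" "\<And>x y. x \<in> B \<Longrightarrow> 0 \<le> y \<Longrightarrow> y \<le> x \<Longrightarrow> y \<in> B"
    and "A \<subseteq> {0..d}" "B \<subseteq> {0..d}" "A \<noteq> {}" "B \<noteq> {}"
  shows "Sup (A \<inter> B) = min (Sup A) (Sup B)"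
proof -
  have bdd: "bdd_above A" "bdd_above B"
    using assms(3,4) by (meson bdd_above_Icc bdd_above_mono)+
  have "A \<subseteq> B \<or> B \<subseteq> A"
  proof (rule ccontr)
    assume "\<not> ?thesis"
    then obtain a b where ab: "a \<in> A" "a \<notin> B" "b \<in> B" "b \<notin> A" by blast
    moreover have "0 \<le> a" "0 \<le> b" using ab assms(3,4) by auto
    ultimately show False using assms(1)[of a b] assms(2)[of b a] by linarith
  qed
  then show ?thesis
  proof
    assume "A \<subseteq> B"
    then show ?thesis
      using cSup_subset_mono[of A B] assms bdd by (simp add: Int_absorb2 min_absorb1)
  next
    assume "B \<subseteq> A"
    then show ?thesis
      using cSup_subset_mono[of B A] assms bdd by (simp add: Int_absorb1 min_absorb2)
  qed
qed

theorem proposition11: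
  fixes \<mu> \<nu> :: "'a::euclidean_space measure"
  assumes "finite_borel_measure \<mu>" and "finite_borel_measure \<nu>"
    and "compact (measure_support \<mu>)" and "compact (measure_support \<nu>)"
    and "measure_support \<mu> \<inter> measure_support \<nu> = {}"
  shows "fourier_dim (add_measure \<mu> \<nu>) = min (fourier_dim \<mu>) (fourier_dim \<nu>)"
proof -
  define E where "E M = {s. 0 \<le> s \<and> s \<le> real DIM('a) \<and> fourier_decay M s}" for M :: "'a measure"
  have comm: "add_measure \<nu> \<mu> = add_measure \<mu> \<nu>"
    using assms(1,2) by (intro add_measure_commute) (simp add: finite_borel_measure_def)
  have disj: "measure_support \<nu> \<inter> measure_support \<mu> = {}" using assms(5) by blast
  \<comment> \<open>Linearity of the transform gives the inclusion from right to left. The other one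
    uses the cutoff argument twice, with the roles of \<mu> and \<nu> exchanged.\<close>
  have "E (add_measure \<mu> \<nu>) = E \<mu> \<inter> E \<nu>"
    using fourier_decay_add_measure[OF assms(1,2)] fourier_decay_add_measureD[OF assms]
      fourier_decay_add_measureD[OF assms(2,1,4,3) disj]
    unfolding E_def comm by blast
  moreover have "Sup (E \<mu> \<inter> E \<nu>) = min (Sup (E \<mu>)) (Sup (E \<nu>))"
  proof (rule Sup_Int_downclosed)
    have "0 \<in> E M" if "finite_borel_measure M" for M
      using fourier_decay_zero[OF that] by (simp add: E_def)
    then show "E \<mu> \<noteq> {}" "E \<nu> \<noteq> {}" using assms(1,2) by blast+
    show "E \<mu> \<subseteq> {0..real DIM('a)}" "E \<nu> \<subseteq> {0..real DIM('a)}" by (auto simp: E_def)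
    have "y \<in> E M" if "finite_borel_measure M" "x \<in> E M" "0 \<le> y" "y \<le> x" for M x y
      using that fourier_decay_antimono[OF that(1,3,4)] by (simp add: E_def)
    then show "\<And>x y. x \<in> E \<mu> \<Longrightarrow> 0 \<le> y \<Longrightarrow> y \<le> x \<Longrightarrow> y \<in> E \<mu>"
      "\<And>x y. x \<in> E \<nu> \<Longrightarrow> 0 \<le> y \<Longrightarrow> y \<le> x \<Longrightarrow> y \<in> E \<nu>" using assms(1,2) by blast+
  qed
  ultimately show ?thesis by (simp add: fourier_dim_def E_def)
qed

end
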